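(* Let $a,b,c\in\mathbb{R}$ with $a\neq0$, let $g:\mathbb{R}\to\mathbb{R}$, $g(x)=ax^2+bx+c$, and let $\delta:=b^2-4ac-2b-7$. Let $(x,y,z)$ be an ordered triple of pairwise distinct real numbers, and set $p:=y-x$, $r:=\frac{z-y}{y-x}$ (so $p\ne0$ and $r\notin\{0,-1\}$). The following statements are equivalent: (i) $(x,y,z)$ is a representative of a 3-cycle of the map $x_{t+1}=g(x_t)$, i.e. $g(x)=y$, $g(y)=z$, $g(z)=x$. (ii) $p$, $x$ and $r$ satisfy $$p=-\frac{r^2+r+1}{a\,r(r+1)},\qquad x=-\frac{b}{2a}+\frac{r^3+2r^2+r+1}{2a\,r(r+1)},$$ and $r$ is a root of the polynomial $$P_\delta(X)=X^6+2X^5-(\delta+3)X^4-2(\delta+3)X^3+(2-\delta)X^2+4X+1.$$ *)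

theory Defs
  imports Complex_Main "HOL-Computational_Algebra.Polynomial"
begin

definition P_poly :: "real \<Rightarrow> real poly" where
  "P_poly \<delta> =
     monom 1 6 + monom 2 5 - monom (\<delta> + 3) 4 - monom (2 * (\<delta> + 3)) 3
       + monom (2 - \<delta>) 2 + monom 4 1 + monom 1 0"

end

theory Submission
  imports Defs
begin

text \<open>With \<open>u = 2 a x + b\<close> and \<open>v = a p\<close>, the equation \<open>g x = y\<close> becomes
  \<open>u\<^sup>2 - 2 u - 4 v = \<delta> + 7\<close>, while dividing \<open>g y - g x = z - y\<close> and
  \<open>g z - g y = x - z\<close> by \<open>p\<close> and \<open>r p\<close> leaves two equations linear in \<open>u, v\<close>. Solving
  these gives the formulas for \<open>p\<close> and \<open>x\<close>, and substituting the solution into the first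
  equation and clearing the denominator \<open>(r (r + 1))\<^sup>2\<close> gives \<open>P\<^sub>\<delta>(r) = 0\<close>.\<close>

lemma poly_P_poly:
  "poly (P_poly \<delta>) r =
     r^6 + 2 * r^5 - (\<delta> + 3) * r^4 - 2 * (\<delta> + 3) * r^3 + (2 - \<delta>) * r\<^sup>2 + 4 * r + 1"
  by (simp add: P_poly_def poly_monom)

text \<open>Substituting \<open>u = r - v\<close> into the second equation leaves \<open>v\<close>
  as the only unknown, with coefficient \<open>r * (r + 1)\<close>. Conversely, the two solved
  equations add up to \<open>r * (r * (r + 1))\<close>, and cancelling the nonzero factor recovers
  \<open>u + v = r\<close>.\<close>

lemma linear_system_iff:
  fixes r u v :: real
  assumes "r * (r + 1) \<noteq> 0"
  shows "u + v = r \<and> r * (u + 2 * v + r * v) = - (1 + r) \<longleftrightarrow>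
    v * (r * (r + 1)) = - (r\<^sup>2 + r + 1) \<and> u * (r * (r + 1)) = r^3 + 2 * r\<^sup>2 + r + 1"
    (is "?L \<longleftrightarrow> ?R")
proof
  assume ?L
  then have u: "u = r - v" and "r * (u + 2 * v + r * v) = - (1 + r)"
    by auto
  then have "v * (r * (r + 1)) = - (r\<^sup>2 + r + 1)"
    by algebra
  then show ?R
    by (simp add: u algebra_simps power2_eq_square power3_eq_cube)
next
  assume R: ?R
  then have "(u + v) * (r * (r + 1)) = r * (r * (r + 1))"
    by (simp add: algebra_simps power2_eq_square power3_eq_cube)
  then have uv: "u + v = r"
    using assms by (metis mult_right_cancel)
  \<comment> \<open>The bracket splits as \<open>(u + v) + v * (r + 1)\<close>.\<close>
  then have "r * (u + 2 * v + r * v) = r\<^sup>2 + v * (r * (r + 1))"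
    by (simp add: algebra_simps power2_eq_square flip: uv)
  with R uv show ?L
    by simp
qed

lemma poly_P_poly_eq_0_iff:
  assumes N: "r * (r + 1) \<noteq> 0"
    and v: "v * (r * (r + 1)) = - (r\<^sup>2 + r + 1)"
    and u: "u * (r * (r + 1)) = r^3 + 2 * r\<^sup>2 + r + 1"
  shows "poly (P_poly \<delta>) r = 0 \<longleftrightarrow> u\<^sup>2 - 2 * u - 4 * v = \<delta> + 7"
proof -
  let ?N = "r * (r + 1)"
  have "(u\<^sup>2 - 2 * u - 4 * v - (\<delta> + 7)) * ?N\<^sup>2 =
      (u * ?N)\<^sup>2 - 2 * (u * ?N) * ?N - 4 * (v * ?N) * ?N - (\<delta> + 7) * ?N\<^sup>2"
    by algebra
  also have "\<dots> = poly (P_poly \<delta>) r"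
    unfolding u v poly_P_poly by algebra
  finally have "poly (P_poly \<delta>) r = (u\<^sup>2 - 2 * u - 4 * v - (\<delta> + 7)) * ?N\<^sup>2" ..
  with N show ?thesis
    by simp
qed

text \<open>Completing the square: the terms linear in \<open>x\<close> from
  \<open>- 2 * (2 * a * x + b)\<close> and \<open>- 4 * (a * (y - x))\<close> cancel, leaving
  \<open>4 * a\<close> times the defect of the left equation.\<close>

lemma quadratic_eq_iff:
  fixes a b c x y :: real
  assumes "a \<noteq> 0"
  shows "a * x\<^sup>2 + b * x + c = y \<longleftrightarrow>
    (2 * a * x + b)\<^sup>2 - 2 * (2 * a * x + b) - 4 * (a * (y - x)) = b\<^sup>2 - 4 * a * c - 2 * b"
    (is "_ \<longleftrightarrow> ?l = ?r")
proof -
  have "?l - ?r = 4 * a * (a * x\<^sup>2 + b * x + c - y)"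
    by algebra
  with assms show ?thesis
    by (metis eq_iff_diff_eq_0 mult_eq_0_iff zero_neq_numeral)
qed

theorem lemma2p2:
  fixes a b c \<delta> x y z p r :: real and g :: "real \<Rightarrow> real"
  assumes a: "a \<noteq> 0"
    and g: "g = (\<lambda>t. a * t\<^sup>2 + b * t + c)"
    and \<delta>: "\<delta> = b\<^sup>2 - 4 * a * c - 2 * b - 7"
    and distinct: "x \<noteq> y" "y \<noteq> z" "x \<noteq> z"
    and p: "p = y - x"
    and r: "r = (z - y) / (y - x)"
  shows "p \<noteq> 0 \<and> r \<notin> {0, -1} \<and>
    ((g x = y \<and> g y = z \<and> g z = x) \<longleftrightarrow>
     (p = - ((r\<^sup>2 + r + 1) / (a * r * (r + 1))) \<and>
      x = - (b / (2 * a)) + (r ^ 3 + 2 * r\<^sup>2 + r + 1) / (2 * a * r * (r + 1)) \<and>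
      poly (P_poly \<delta>) r = 0))"
proof -
  have p0: "p \<noteq> 0"
    using distinct p by simp
  have r0: "r \<noteq> 0"
    using distinct r by simp
  \<comment> \<open>This form shows that \<open>x \<noteq> z\<close> is what excludes
    \<open>r = -1\<close>.\<close>
  have "r + 1 = (z - x) / (y - x)"
    using distinct by (simp add: r field_simps)
  then have r1: "r + 1 \<noteq> 0"
    using distinct by simp
  have y: "y = x + p"
    by (simp add: p)
  have z: "z = x + p + r * p"
    using p0 by (simp add: p r)
  define u where "u = 2 * a * x + b"
  define v where "v = a * p"
  have N: "r * (r + 1) \<noteq> 0"
    using r0 r1 by simp
  have gx: "g x = y \<longleftrightarrow> u\<^sup>2 - 2 * u - 4 * v = \<delta> + 7"
    using quadratic_eq_iff[OF a, of x b c y] by (simp add: g \<delta> u_def v_def p)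
  have "g y - g x = p * (u + v)"
    unfolding g y u_def v_def by algebra
  then have gy: "g y - g x = z - y \<longleftrightarrow> u + v = r"
    using p0 by (simp add: y z)
  \<comment> \<open>The step from \<open>y\<close> to \<open>z\<close> is \<open>r * p\<close>, and
    the secant slope \<open>a * (y + z) + b\<close> equals \<open>u + 2 * v + r * v\<close>.\<close>
  have "g z - g y = p * (r * (u + 2 * v + r * v))"
    unfolding g z y u_def v_def by algebra
  moreover have "x - z = p * (- (1 + r))"
    by (simp add: z algebra_simps)
  ultimately have gz: "g z - g y = x - z \<longleftrightarrow> r * (u + 2 * v + r * v) = - (1 + r)"
    using p0 by (metis mult_left_cancel)
  have "g x = y \<and> g y = z \<and> g z = x \<longleftrightarrow>
      g x = y \<and> g y - g x = z - y \<and> g z - g y = x - z"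
    by auto
  \<comment> \<open>The linear system is solved first: \<open>g x = y\<close> can be traded for the
    root condition only once \<open>u\<close> and \<open>v\<close> have their solved values.\<close>
  also have "\<dots> \<longleftrightarrow> v * (r * (r + 1)) = - (r\<^sup>2 + r + 1) \<and>
      u * (r * (r + 1)) = r^3 + 2 * r\<^sup>2 + r + 1 \<and> poly (P_poly \<delta>) r = 0"
    unfolding gx gy gz using linear_system_iff[OF N, of u v] poly_P_poly_eq_0_iff[OF N, of v u \<delta>]
    by blast
  also have "v * (r * (r + 1)) = - (r\<^sup>2 + r + 1) \<longleftrightarrow>
      p = - ((r\<^sup>2 + r + 1) / (a * r * (r + 1)))"
  proof -
    have "a * r * (r + 1) \<noteq> 0" "v * (r * (r + 1)) = p * (a * r * (r + 1))"
      using a r0 r1 by (auto simp: v_def)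
    then show ?thesis
      by (metis minus_divide_left nonzero_eq_divide_eq)
  qed
  also have "u * (r * (r + 1)) = r^3 + 2 * r\<^sup>2 + r + 1 \<longleftrightarrow>
      x = - (b / (2 * a)) + (r^3 + 2 * r\<^sup>2 + r + 1) / (2 * a * r * (r + 1))"
  proof -
    have "2 * a * r * (r + 1) \<noteq> 0"
      using a r0 r1 by simp
    moreover have "u * (r * (r + 1)) = (x + b / (2 * a)) * (2 * a * r * (r + 1))"
      using a by (simp add: u_def field_simps)
    ultimately have "u * (r * (r + 1)) = r^3 + 2 * r\<^sup>2 + r + 1 \<longleftrightarrow>
        x + b / (2 * a) = (r^3 + 2 * r\<^sup>2 + r + 1) / (2 * a * r * (r + 1))"
      by (metis nonzero_eq_divide_eq)
    then show ?thesis
      by linarith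
  qed
  finally show ?thesis
    using p0 r0 r1 by auto
qed

end
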